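(* Let $R$ be a Gelfand ring. Then $\operatorname{Ker}\pi_{\mathfrak{m}}$ is a pure ideal of $R$ for every maximal ideal $\mathfrak{m}$ of $R$.
   Context: All rings are commutative with identity. A ring $R$ is called a Gelfand ring (pm-ring) if every prime ideal of $R$ is contained in a unique maximal ideal. An ideal $I$ of $R$ is pure if the canonical homomorphism $R\to R/I$ is flat; equivalently, for each $a\in I$ there exists $b\in I$ with $a(1-b)=0$. For a prime ideal $\mathfrak{p}$, $\pi_{\mathfrak{p}}:R\to R_{\mathfrak{p}}=(R\setminus\mathfrak{p})^{-1}R$ denotes the natural localization homomorphism. *)

theory Defs
  imports "HOL-Algebra.Algebra" "HOL-Algebra.Free_Abelian_Groups"
begin

definition gelfand_ring :: "('a, 'b) ring_scheme \<Rightarrow> bool" where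
  "gelfand_ring R \<longleftrightarrow>
     cring R \<and> (\<forall>P. primeideal P R \<longrightarrow> (\<exists>!M. maximalideal M R \<and> P \<subseteq> M))"


section \<open>Localization\<close>

definition fraction_rel :: "('a, 'b) ring_scheme \<Rightarrow> 'a set \<Rightarrow> (('a \<times> 'a) \<times> ('a \<times> 'a)) set" where
  "fraction_rel R S =
     {((a, s), (b, t)) | a s b t.
        a \<in> carrier R \<and> s \<in> S \<and> b \<in> carrier R \<and> t \<in> S \<and>
        (\<exists>u\<in>S. u \<otimes>\<^bsub>R\<^esub> (a \<otimes>\<^bsub>R\<^esub> t \<ominus>\<^bsub>R\<^esub> b \<otimes>\<^bsub>R\<^esub> s) = \<zero>\<^bsub>R\<^esub>)}"

definition fraction :: "('a, 'b) ring_scheme \<Rightarrow> 'a set \<Rightarrow> 'a \<Rightarrow> 'a \<Rightarrow> ('a \<times> 'a) set" where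
  "fraction R S a s = fraction_rel R S `` {(a, s)}"

text \<open>In \<open>add\<close> and \<open>mult\<close> the unions range over all representatives; as the results do not
  depend on the representatives, each union is a single class.\<close>

definition localization :: "('a, 'b) ring_scheme \<Rightarrow> 'a set \<Rightarrow> ('a \<times> 'a) set ring" where
  "localization R S =
     \<lparr>carrier = (carrier R \<times> S) // fraction_rel R S,
      monoid.mult = (\<lambda>A B. \<Union>(a, s)\<in>A. \<Union>(b, t)\<in>B. fraction R S (a \<otimes>\<^bsub>R\<^esub> b) (s \<otimes>\<^bsub>R\<^esub> t)),
      one = fraction R S \<one>\<^bsub>R\<^esub> \<one>\<^bsub>R\<^esub>,
      ring.zero = fraction R S \<zero>\<^bsub>R\<^esub> \<one>\<^bsub>R\<^esub>,
      add = (\<lambda>A B. \<Union>(a, s)\<in>A. \<Union>(b, t)\<in>B.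
               fraction R S (a \<otimes>\<^bsub>R\<^esub> t \<oplus>\<^bsub>R\<^esub> b \<otimes>\<^bsub>R\<^esub> s) (s \<otimes>\<^bsub>R\<^esub> t))\<rparr>"

definition localization_at :: "('a, 'b) ring_scheme \<Rightarrow> 'a set \<Rightarrow> ('a \<times> 'a) set ring" where
  "localization_at R P = localization R (carrier R - P)"

definition localization_map :: "('a, 'b) ring_scheme \<Rightarrow> 'a set \<Rightarrow> 'a \<Rightarrow> ('a \<times> 'a) set" where
  "localization_map R P a = fraction R (carrier R - P) a \<one>\<^bsub>R\<^esub>"


section \<open>Tensor products and flatness\<close>

definition mod_hom ::
  "('a, 'b) ring_scheme \<Rightarrow> ('a, 'm, 'p) module_scheme \<Rightarrow> ('a, 'n, 'q) module_scheme \<Rightarrow> ('m \<Rightarrow> 'n) set"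
  where
  "mod_hom R M N =
     {f \<in> carrier M \<rightarrow> carrier N.
        (\<forall>x\<in>carrier M. \<forall>y\<in>carrier M. f (x \<oplus>\<^bsub>M\<^esub> y) = f x \<oplus>\<^bsub>N\<^esub> f y) \<and>
        (\<forall>r\<in>carrier R. \<forall>x\<in>carrier M. f (r \<odot>\<^bsub>M\<^esub> x) = r \<odot>\<^bsub>N\<^esub> f x)}"

definition tensor_rels ::
  "('a, 'b) ring_scheme \<Rightarrow> ('a, 'm, 'p) module_scheme \<Rightarrow> ('a, 'n, 'q) module_scheme
    \<Rightarrow> ('m \<times> 'n \<Rightarrow>\<^sub>0 int) set"
  where
  "tensor_rels R M N =
     {frag_of (x \<oplus>\<^bsub>M\<^esub> x', y) - frag_of (x, y) - frag_of (x', y) | x x' y.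
        x \<in> carrier M \<and> x' \<in> carrier M \<and> y \<in> carrier N} \<union>
     {frag_of (x, y \<oplus>\<^bsub>N\<^esub> y') - frag_of (x, y) - frag_of (x, y') | x y y'.
        x \<in> carrier M \<and> y \<in> carrier N \<and> y' \<in> carrier N} \<union>
     {frag_of (r \<odot>\<^bsub>M\<^esub> x, y) - frag_of (x, r \<odot>\<^bsub>N\<^esub> y) | r x y.
        r \<in> carrier R \<and> x \<in> carrier M \<and> y \<in> carrier N}"

definition tensor_subgroup ::
  "('a, 'b) ring_scheme \<Rightarrow> ('a, 'm, 'p) module_scheme \<Rightarrow> ('a, 'n, 'q) module_scheme
    \<Rightarrow> ('m \<times> 'n \<Rightarrow>\<^sub>0 int) set"
  where
  "tensor_subgroup R M N =
     generate (free_Abelian_group (carrier M \<times> carrier N)) (tensor_rels R M N)"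

text \<open>Only the underlying abelian group (written multiplicatively, as in \<open>free_Abelian_group\<close>) of
  the tensor product over \<open>R\<close> is constructed: injectivity of an induced map does not involve the
  \<open>R\<close>-action.\<close>

definition tensor_product ::
  "('a, 'b) ring_scheme \<Rightarrow> ('a, 'm, 'p) module_scheme \<Rightarrow> ('a, 'n, 'q) module_scheme
    \<Rightarrow> ('m \<times> 'n \<Rightarrow>\<^sub>0 int) set monoid"
  where
  "tensor_product R M N =
     free_Abelian_group (carrier M \<times> carrier N) Mod tensor_subgroup R M N"

text \<open>The map from \<open>L \<otimes> M\<close> to \<open>N \<otimes> M\<close> induced by \<open>f\<close> from \<open>L\<close> to \<open>N\<close>, sending the class of
  \<open>(x, y)\<close> to the class of \<open>(f x, y)\<close>.\<close>

definition tensor_map_left ::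
  "('a, 'b) ring_scheme \<Rightarrow> ('a, 'n, 'q) module_scheme \<Rightarrow> ('a, 'm, 'p) module_scheme
    \<Rightarrow> ('l \<Rightarrow> 'n) \<Rightarrow> ('l \<times> 'm \<Rightarrow>\<^sub>0 int) set \<Rightarrow> ('n \<times> 'm \<Rightarrow>\<^sub>0 int) set"
  where
  "tensor_map_left R N M f C =
     (\<Union>c\<in>C. tensor_subgroup R N M #>\<^bsub>free_Abelian_group (carrier N \<times> carrier M)\<^esub>
               frag_extend (\<lambda>(x, y). frag_of (f x, y)) c)"

text \<open>Flatness quantifies over all injective maps of modules. A definition can only quantify over
  modules whose elements live in given types; these types are the two type arguments. A theorem
  that concludes flatness with both types left as type variables concludes it for all modules.\<close>

definition flat_module ::
  "'l itself \<Rightarrow> 'n itself \<Rightarrow> ('a, 'b) ring_scheme \<Rightarrow> ('a, 'm, 'p) module_scheme \<Rightarrow> bool" where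
  "flat_module TL TN R M \<longleftrightarrow>
     module R M \<and>
     (\<forall>(L :: ('a, 'l) module) (N :: ('a, 'n) module) f.
        module R L \<longrightarrow> module R N \<longrightarrow> f \<in> mod_hom R L N \<longrightarrow> inj_on f (carrier L) \<longrightarrow>
        inj_on (tensor_map_left R N M f) (carrier (tensor_product R L M)))"

definition restrict_scalars ::
  "('a, 'b) ring_scheme \<Rightarrow> ('c, 'd) ring_scheme \<Rightarrow> ('a \<Rightarrow> 'c) \<Rightarrow> ('a, 'c) module" where
  "restrict_scalars R S h =
     \<lparr>carrier = carrier S, monoid.mult = monoid.mult S, one = one S, ring.zero = ring.zero S, add = add S,
      smult = (\<lambda>r x. h r \<otimes>\<^bsub>S\<^esub> x)\<rparr>"

definition flat_ring_hom ::
  "'l itself \<Rightarrow> 'n itself \<Rightarrow> ('a, 'b) ring_scheme \<Rightarrow> ('c, 'd) ring_scheme \<Rightarrow> ('a \<Rightarrow> 'c) \<Rightarrow> bool"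
  where
  "flat_ring_hom TL TN R S h \<longleftrightarrow>
     h \<in> ring_hom R S \<and> flat_module TL TN R (restrict_scalars R S h)"

definition pure_ideal ::
  "'l itself \<Rightarrow> 'n itself \<Rightarrow> 'a set \<Rightarrow> ('a, 'b) ring_scheme \<Rightarrow> bool" where
  "pure_ideal TL TN I R \<longleftrightarrow>
     ideal I R \<and> flat_ring_hom TL TN R (R Quot I) (\<lambda>a. I +>\<^bsub>R\<^esub> a)"

end

theory Submission
  imports Defs
begin

text \<open>
  Write \<open>K\<close> for the kernel of the localization map at the maximal ideal \<open>\<mm>\<close>. It consists of the
  elements killed by something outside \<open>\<mm>\<close>. The proof has two independent halves.

  The first half is the elementwise purity of \<open>K\<close>: every \<open>a \<in> K\<close> satisfies \<open>a = b a\<close> for some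
  \<open>b \<in> K\<close> (\<open>gelfand_localization_kernel_pure\<close>). If \<open>u \<notin> \<mm>\<close> kills \<open>a\<close>, it is enough to write
  \<open>1 = b + r u\<close> with \<open>b \<in> K\<close>. Otherwise \<open>K\<close> and \<open>u\<close> lie in a common prime \<open>Q\<close>. No product of an
  element outside \<open>\<mm>\<close> with an element \<open>t\<close> outside \<open>Q\<close> vanishes, as \<open>t\<close> would then belong to
  \<open>K \<subseteq> Q\<close>. These products therefore form a multiplicative set without \<open>0\<close>, and a prime that
  avoids it (\<open>exists_primeideal_disjoint\<close>) is contained in both \<open>\<mm>\<close> and \<open>Q\<close>. By the Gelfand
  property \<open>\<mm>\<close> is the only maximal ideal above that prime, so \<open>u \<in> Q \<subseteq> \<mm>\<close>, a contradiction.

  The second half is the passage from elements to flatness, for any ideal \<open>I\<close> with the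
  elementwise property (\<open>flat_quotient_of_pure\<close>). Every element of \<open>L \<otimes> R/I\<close> has the form
  \<open>x \<otimes> 1\<close> (\<open>tensor_quotient_normal_form\<close>). If \<open>y \<otimes> 1 = 0\<close> in \<open>N \<otimes> R/I\<close>, then \<open>b y = y\<close> for a single
  \<open>b \<in> I\<close> (\<open>contraction_of_tensor_subgroup\<close>), because the elements fixed by some member of \<open>I\<close> form
  a submodule, and by purity that submodule contains \<open>I N\<close>. So if an injective \<open>f\<close> sends
  \<open>x \<otimes> 1\<close> to \<open>0\<close>, then \<open>f (b x) = b f x = f x\<close> for such a \<open>b\<close>, hence
  \<open>x = b x\<close> and \<open>x \<otimes> 1 = x \<otimes> b = 0\<close>.
\<close>

section \<open>Prime ideals avoiding a multiplicative set\<close>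

lemma (in ring) ideal_Union_chain:
  assumes ideal: "\<And>J. J \<in> C \<Longrightarrow> ideal J R"
    and "C \<noteq> {}"
    and chain: "\<And>J K. J \<in> C \<Longrightarrow> K \<in> C \<Longrightarrow> J \<subseteq> K \<or> K \<subseteq> J"
  shows "ideal (\<Union>C) R"
proof (rule idealI[OF ring_axioms])
  have additive: "additive_subgroup J R" if "J \<in> C" for J
    using ideal[OF that] by (rule ideal.axioms(1))
  show "subgroup (\<Union>C) (add_monoid R)"
  proof (rule add.subgroupI)
    show "\<Union>C \<subseteq> carrier R"
      using additive_subgroup.a_subset[OF additive] by (rule Union_least)
    obtain J where J: "J \<in> C"
      using \<open>C \<noteq> {}\<close> by blast
    then have "\<zero> \<in> J"
      by (intro additive_subgroup.zero_closed additive)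
    with J show "\<Union>C \<noteq> {}"
      by blast
    show "\<ominus> a \<in> \<Union>C" if a: "a \<in> \<Union>C" for a
    proof -
      obtain J where J: "J \<in> C" "a \<in> J"
        using a by blast
      have "\<ominus> a \<in> J"
        unfolding a_inv_def
        by (rule subgroup.m_inv_closed[OF additive_subgroup.a_subgroup[OF additive[OF J(1)]] J(2)])
      with J(1) show ?thesis
        by blast
    qed
    show "a \<oplus> b \<in> \<Union>C" if ab: "a \<in> \<Union>C" "b \<in> \<Union>C" for a b
    proof -
      obtain J K where JK: "J \<in> C" "a \<in> J" "K \<in> C" "b \<in> K"
        using ab by blast
      then obtain H where H: "H \<in> C" "a \<in> H" "b \<in> H"
        using chain[OF JK(1,3)] by blast
      have "a \<oplus> b \<in> H"
        by (rule additive_subgroup.a_closed[OF additive[OF H(1)] H(2,3)])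
      with H(1) show ?thesis
        by blast
    qed
  qed
next
  fix a x assume "a \<in> \<Union>C" and x: "x \<in> carrier R"
  then obtain J where J: "J \<in> C" "a \<in> J"
    by blast
  show "x \<otimes> a \<in> \<Union>C"
    using ideal.I_l_closed[OF ideal[OF J(1)] J(2) x] J(1) by blast
  show "a \<otimes> x \<in> \<Union>C"
    using ideal.I_r_closed[OF ideal[OF J(1)] J(2) x] J(1) by blast
qed

lemma (in cring) ideal_add_principal:
  assumes "ideal I R" "a \<in> carrier R"
  shows "ideal (I <+>\<^bsub>R\<^esub> PIdl a) R"
    and "I \<subseteq> I <+>\<^bsub>R\<^esub> PIdl a"
    and "a \<in> I <+>\<^bsub>R\<^esub> PIdl a"
    and "x \<in> I <+>\<^bsub>R\<^esub> PIdl a \<Longrightarrow> \<exists>p\<in>I. \<exists>r\<in>carrier R. x = p \<oplus> r \<otimes> a"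
proof -
  interpret I: ideal I R by fact
  have mem_iff: "x \<in> I <+>\<^bsub>R\<^esub> PIdl a \<longleftrightarrow> (\<exists>p\<in>I. \<exists>r\<in>carrier R. x = p \<oplus> r \<otimes> a)" for x
    by (auto simp: set_add_def' cgenideal_def)
  show "ideal (I <+>\<^bsub>R\<^esub> PIdl a) R"
    using assms cgenideal_ideal add_ideals by blast
  show "I \<subseteq> I <+>\<^bsub>R\<^esub> PIdl a"
  proof
    fix p assume p: "p \<in> I"
    then have "p = p \<oplus> \<zero> \<otimes> a"
      using assms(2) I.Icarr by simp
    with p show "p \<in> I <+>\<^bsub>R\<^esub> PIdl a"
      unfolding mem_iff by blast
  qed
  have "a = \<zero> \<oplus> \<one> \<otimes> a"
    using assms(2) by simp
  then show "a \<in> I <+>\<^bsub>R\<^esub> PIdl a"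
    unfolding mem_iff using I.zero_closed one_closed by blast
  show "\<exists>p\<in>I. \<exists>r\<in>carrier R. x = p \<oplus> r \<otimes> a" if "x \<in> I <+>\<^bsub>R\<^esub> PIdl a"
    using that unfolding mem_iff .
qed

text \<open>By Zorn's lemma there is an ideal \<open>P\<close> maximal among those that contain \<open>I\<close> and miss \<open>S\<close>. It is
  prime: if \<open>a\<close> and \<open>b\<close> lie outside \<open>P\<close>, then \<open>P + (a)\<close> and \<open>P + (b)\<close> both meet \<open>S\<close>, and if \<open>a b\<close>
  were in \<open>P\<close>, the product of two such elements of \<open>S\<close> would be in \<open>P\<close>.\<close>

lemma (in cring) exists_primeideal_disjoint:
  assumes "ideal I R"
    and S: "S \<subseteq> carrier R" "\<one> \<in> S" "\<And>s t. s \<in> S \<Longrightarrow> t \<in> S \<Longrightarrow> s \<otimes> t \<in> S"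
    and "I \<inter> S = {}"
  obtains P where "primeideal P R" "I \<subseteq> P" "P \<inter> S = {}"
proof -
  define A where "A = {J. ideal J R \<and> I \<subseteq> J \<and> J \<inter> S = {}}"
  have "\<exists>P\<in>A. \<forall>J\<in>A. P \<subseteq> J \<longrightarrow> J = P"
  proof (rule subset_Zorn_nonempty)
    show "A \<noteq> {}"
      using assms(1,5) unfolding A_def by blast
    fix C assume C: "C \<noteq> {}" "subset.chain A C"
    then have A: "J \<in> A" if "J \<in> C" for J
      using that by (auto simp: subset_chain_def)
    have "ideal (\<Union>C) R"
    proof (rule ideal_Union_chain)
      show "ideal J R" if "J \<in> C" for J
        using A[OF that] by (simp add: A_def)
      show "J \<subseteq> K \<or> K \<subseteq> J" if "J \<in> C" "K \<in> C" for J K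
        using C(2) that by (auto simp: subset_chain_def)
    qed (rule C(1))
    moreover have "I \<subseteq> \<Union>C"
      using A C(1) by (auto simp: A_def)
    moreover have "\<Union>C \<inter> S = {}"
      using A by (auto simp: A_def)
    ultimately show "\<Union>C \<in> A"
      by (simp add: A_def)
  qed
  then obtain P where "P \<in> A" and A_max: "\<forall>J\<in>A. P \<subseteq> J \<longrightarrow> J = P"
    by (elim bexE)
  then have P: "ideal P R" "I \<subseteq> P" "P \<inter> S = {}"
    by (simp_all add: A_def)
  have max: "J = P" if "ideal J R" "P \<subseteq> J" "J \<inter> S = {}" for J
    using A_max that P(2) by (auto simp: A_def)
  interpret P: ideal P R by fact
  have meets: "\<exists>p\<in>P. \<exists>r\<in>carrier R. p \<oplus> r \<otimes> a \<in> S" if a: "a \<in> carrier R" "a \<notin> P" for a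
  proof -
    note J = ideal_add_principal[OF P(1) a(1)]
    have "(P <+>\<^bsub>R\<^esub> PIdl a) \<inter> S \<noteq> {}"
      using max[OF J(1,2)] J(3) a(2) by blast
    then show ?thesis
      using J(4) by blast
  qed
  have "primeideal P R"
  proof (rule primeidealI[OF P(1) is_cring])
    show "carrier R \<noteq> P"
      using P(3) S by blast
    fix a b assume ab: "a \<in> carrier R" "b \<in> carrier R" "a \<otimes> b \<in> P"
    show "a \<in> P \<or> b \<in> P"
    proof (rule ccontr)
      assume "\<not> (a \<in> P \<or> b \<in> P)"
      then obtain p r q t where pr: "p \<in> P" "r \<in> carrier R" "p \<oplus> r \<otimes> a \<in> S"
        and qt: "q \<in> P" "t \<in> carrier R" "q \<oplus> t \<otimes> b \<in> S"
        using meets ab by meson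
      have "(p \<oplus> r \<otimes> a) \<otimes> (q \<oplus> t \<otimes> b)
          = p \<otimes> (q \<oplus> t \<otimes> b) \<oplus> ((r \<otimes> a) \<otimes> q \<oplus> (r \<otimes> t) \<otimes> (a \<otimes> b))"
        using ab(1,2) pr(2) qt(2) P.Icarr[OF pr(1)] P.Icarr[OF qt(1)]
        by (simp add: l_distr r_distr m_ac a_ac)
      also have "\<dots> \<in> P"
        by (intro P.a_closed P.I_r_closed[OF pr(1)] P.I_l_closed[OF qt(1)] P.I_l_closed[OF ab(3)])
          (use ab pr(2) qt(2) P.Icarr[OF qt(1)] in auto)
      finally show False
        using S(3)[OF pr(3) qt(3)] P(3) by blast
    qed
  qed
  then show ?thesis
    using that P(2,3) by blast
qed


section \<open>The kernel of a localization\<close>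

lemma (in cring) equiv_fraction_rel:
  assumes S: "S \<subseteq> carrier R" "\<one> \<in> S" "\<And>s t. s \<in> S \<Longrightarrow> t \<in> S \<Longrightarrow> s \<otimes> t \<in> S"
  shows "equiv (carrier R \<times> S) (fraction_rel R S)"
proof (rule equivI)
  note carr [simp] = subsetD[OF S(1)]
  show "fraction_rel R S \<subseteq> (carrier R \<times> S) \<times> carrier R \<times> S"
    by (auto simp: fraction_rel_def)
  show "refl_on (carrier R \<times> S) (fraction_rel R S)"
    using S(2) by (auto simp: refl_on_def fraction_rel_def intro!: bexI[of _ \<one>])
  show "sym (fraction_rel R S)"
  proof (rule symI)
    fix p q assume "(p, q) \<in> fraction_rel R S"
    then obtain a s b t u where pq: "p = (a, s)" "q = (b, t)"
      and mem: "a \<in> carrier R" "s \<in> S" "b \<in> carrier R" "t \<in> S" "u \<in> S"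
      and u: "u \<otimes> (a \<otimes> t \<ominus> b \<otimes> s) = \<zero>"
      by (auto simp: fraction_rel_def)
    have "u \<otimes> (b \<otimes> s \<ominus> a \<otimes> t) = \<ominus> (u \<otimes> (a \<otimes> t \<ominus> b \<otimes> s))"
      using mem carr[OF mem(2)] carr[OF mem(4)] carr[OF mem(5)] unfolding minus_eq by algebra
    also have "\<dots> = \<zero>"
      using u by simp
    finally show "(q, p) \<in> fraction_rel R S"
      using mem pq by (auto simp: fraction_rel_def)
  qed
  show "trans (fraction_rel R S)"
  proof (rule transI)
    fix p q w assume "(p, q) \<in> fraction_rel R S" "(q, w) \<in> fraction_rel R S"
    then obtain a s b t c r u v where pq: "p = (a, s)" "q = (b, t)" "w = (c, r)"
      and mem: "a \<in> carrier R" "s \<in> S" "b \<in> carrier R" "t \<in> S" "c \<in> carrier R" "r \<in> S"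
        "u \<in> S" "v \<in> S"
      and u: "u \<otimes> (a \<otimes> t \<ominus> b \<otimes> s) = \<zero>" and v: "v \<otimes> (b \<otimes> r \<ominus> c \<otimes> t) = \<zero>"
      by (auto simp: fraction_rel_def)
    note cmem = carr[OF mem(2)] carr[OF mem(4)] carr[OF mem(6)] carr[OF mem(7)] carr[OF mem(8)]
    \<comment> \<open>The middle denominator \<open>t\<close> must be part of the witness: in the presence of zero divisors
      it cannot be cancelled.\<close>
    have "(u \<otimes> v \<otimes> t) \<otimes> (a \<otimes> r \<ominus> c \<otimes> s)
        = (v \<otimes> r) \<otimes> (u \<otimes> (a \<otimes> t \<ominus> b \<otimes> s)) \<oplus> (u \<otimes> s) \<otimes> (v \<otimes> (b \<otimes> r \<ominus> c \<otimes> t))"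
      using mem(1,3,5) cmem unfolding minus_eq by algebra
    also have "\<dots> = \<zero>"
      using u v cmem by simp
    finally have "\<exists>u\<in>S. u \<otimes> (a \<otimes> r \<ominus> c \<otimes> s) = \<zero>"
      using S(3) mem by blast
    then show "(p, w) \<in> fraction_rel R S"
      using mem pq by (auto simp: fraction_rel_def)
  qed
qed

lemma (in primeideal) kernel_localization_map:
  "a_kernel R (localization_at R I) (localization_map R I)
     = {a \<in> carrier R. \<exists>u\<in>carrier R - I. u \<otimes> a = \<zero>}"
proof -
  let ?S = "carrier R - I"
  have one: "\<one> \<in> ?S"
    using I_notcarr one_imp_carrier by blast
  have "equiv (carrier R \<times> ?S) (fraction_rel R ?S)"
    using one I_prime by (intro equiv_fraction_rel) auto
  then have "fraction R ?S a \<one> = fraction R ?S \<zero> \<one> \<longleftrightarrow> ((a, \<one>), (\<zero>, \<one>)) \<in> fraction_rel R ?S"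
    if "a \<in> carrier R" for a
    using that one unfolding fraction_def by (intro eq_equiv_class_iff) auto
  moreover have "((a, \<one>), (\<zero>, \<one>)) \<in> fraction_rel R ?S \<longleftrightarrow> (\<exists>u\<in>?S. u \<otimes> a = \<zero>)"
    if "a \<in> carrier R" for a
    using that one by (simp add: fraction_rel_def minus_eq)
  ultimately show ?thesis
    by (auto simp: a_kernel_def kernel_def localization_at_def localization_map_def localization_def)
qed

lemma (in primeideal) ideal_kernel_localization_map:
  "ideal (a_kernel R (localization_at R I) (localization_map R I)) R"
  unfolding kernel_localization_map
proof (rule idealI[OF ring_axioms])
  let ?K = "{a \<in> carrier R. \<exists>u\<in>carrier R - I. u \<otimes> a = \<zero>}"
  show "subgroup ?K (add_monoid R)"
  proof (rule add.subgroupI)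
    have "\<one> \<notin> I"
      using I_notcarr one_imp_carrier by blast
    then have "\<zero> \<in> ?K"
      by (auto intro!: bexI[of _ \<one>])
    then show "?K \<noteq> {}"
      by blast
    show "\<ominus> a \<in> ?K" if "a \<in> ?K" for a
      using that by (auto simp: r_minus intro!: bexI)
    show "a \<oplus> b \<in> ?K" if ab: "a \<in> ?K" "b \<in> ?K" for a b
    proof -
      obtain u v where uv: "u \<in> carrier R" "u \<notin> I" "u \<otimes> a = \<zero>" "v \<in> carrier R" "v \<notin> I" "v \<otimes> b = \<zero>"
        using ab by blast
      have "(u \<otimes> v) \<otimes> (a \<oplus> b) = v \<otimes> (u \<otimes> a) \<oplus> u \<otimes> (v \<otimes> b)"
        using ab uv(1,4) by (simp, algebra)
      then have "(u \<otimes> v) \<otimes> (a \<oplus> b) = \<zero>" 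
        using uv by simp
      moreover have "u \<otimes> v \<in> carrier R - I"
        using uv I_prime by auto
      ultimately show ?thesis
        using ab by blast
    qed
  qed auto
next
  let ?K = "{a \<in> carrier R. \<exists>u\<in>carrier R - I. u \<otimes> a = \<zero>}"
  fix a x assume "a \<in> ?K" and x: "x \<in> carrier R"
  then obtain u where u: "a \<in> carrier R" "u \<in> carrier R - I" "u \<otimes> a = \<zero>"
    by blast
  have "u \<otimes> (a \<otimes> x) = (u \<otimes> a) \<otimes> x"
    using u(1,2) x by (simp add: m_assoc)
  then have "u \<otimes> (a \<otimes> x) = \<zero>"
    using u x by simp
  then show "a \<otimes> x \<in> ?K"
    using u x by auto
  then show "x \<otimes> a \<in> ?K"
    using u(1) x by (simp add: m_comm)
qed


section \<open>Elementwise purity over a Gelfand ring\<close>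

text \<open>The Gelfand property enters through a prime \<open>P\<close> below both \<open>\<mm>\<close> and \<open>Q\<close>: it forces every maximal
  ideal above \<open>Q\<close> to be \<open>\<mm>\<close>. Such a \<open>P\<close> is found by avoiding all products \<open>s t\<close> with \<open>s \<notin> \<mm>\<close>
  and \<open>t \<notin> Q\<close>.\<close>

lemma gelfand_localization_kernel_pure:
  fixes R (structure)
  assumes "gelfand_ring R" "maximalideal \<mm> R"
    and a: "a \<in> a_kernel R (localization_at R \<mm>) (localization_map R \<mm>)"
  shows "\<exists>b \<in> a_kernel R (localization_at R \<mm>) (localization_map R \<mm>). b \<otimes> a = a"
proof -
  interpret cring R
    using assms(1) by (simp add: gelfand_ring_def)
  interpret \<mm>: primeideal \<mm> R
    using assms(2) by (rule maximalideal_prime)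
  define K where "K = a_kernel R (localization_at R \<mm>) (localization_map R \<mm>)"
  have K_eq: "K = {a \<in> carrier R. \<exists>u\<in>carrier R - \<mm>. u \<otimes> a = \<zero>}"
    unfolding K_def by (rule \<mm>.kernel_localization_map)
  have K_ideal: "ideal K R"
    unfolding K_def by (rule \<mm>.ideal_kernel_localization_map)
  then interpret K: ideal K R .
  obtain u where u: "a \<in> carrier R" "u \<in> carrier R" "u \<notin> \<mm>" "u \<otimes> a = \<zero>"
    using a unfolding K_def[symmetric] K_eq by blast
  let ?J = "K <+>\<^bsub>R\<^esub> PIdl u"
  note J = ideal_add_principal[OF K_ideal u(2)]
  have "\<one> \<in> ?J"
  proof (rule ccontr)
    assume "\<one> \<notin> ?J"
    then obtain Q where Q: "primeideal Q R" "?J \<subseteq> Q"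
      using exists_primeideal_disjoint[OF J(1), of "{\<one>}"] by auto
    interpret Q: primeideal Q R by fact
    have one: "\<one> \<in> carrier R - \<mm>" "\<one> \<in> carrier R - Q"
      using \<mm>.I_notcarr \<mm>.one_imp_carrier Q.I_notcarr Q.one_imp_carrier by blast+
    define S where "S = {s \<otimes> t | s t. s \<in> carrier R - \<mm> \<and> t \<in> carrier R - Q}"
    have S_mem: "s \<in> S" if "s \<in> carrier R" "s \<notin> \<mm> \<or> s \<notin> Q" for s
    proof (cases "s \<in> \<mm>")
      case True
      then have "s = \<one> \<otimes> s" "s \<in> carrier R - Q"
        using that by auto
      then show ?thesis
        unfolding S_def using one(1) by blast
    next
      case False
      then have "s = s \<otimes> \<one>" "s \<in> carrier R - \<mm>"
        using that by auto
      then show ?thesis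
        unfolding S_def using one(2) by blast
    qed
    have S_sub: "S \<subseteq> carrier R"
      by (auto simp: S_def)
    have S_mult: "x \<otimes> y \<in> S" if xy: "x \<in> S" "y \<in> S" for x y
    proof -
      obtain s t s' t' where x: "x = s \<otimes> t" "s \<in> carrier R - \<mm>" "t \<in> carrier R - Q"
        and y: "y = s' \<otimes> t'" "s' \<in> carrier R - \<mm>" "t' \<in> carrier R - Q"
        using xy unfolding S_def by blast
      have "x \<otimes> y = (s \<otimes> s') \<otimes> (t \<otimes> t')"
        using x y by (simp add: m_ac)
      moreover have "s \<otimes> s' \<in> carrier R - \<mm>" "t \<otimes> t' \<in> carrier R - Q"
        using x y \<mm>.I_prime Q.I_prime by auto
      ultimately show ?thesis
        unfolding S_def by blast
    qed
    have zero: "\<zero> \<notin> S"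
    proof
      assume "\<zero> \<in> S"
      then obtain s t where "s \<in> carrier R - \<mm>" "t \<in> carrier R - Q" "s \<otimes> t = \<zero>"
        unfolding S_def by force
      then have "t \<in> K"
        unfolding K_eq by auto
      then show False
        using J(2) Q(2) \<open>t \<in> carrier R - Q\<close> by blast
    qed
    have "\<one> \<in> S"
      using S_mem one by blast
    moreover have "{\<zero>} \<inter> S = {}"
      using zero by simp
    ultimately obtain P where P: "primeideal P R" "P \<inter> S = {}"
      using exists_primeideal_disjoint[OF zeroideal S_sub _ S_mult] by metis
    interpret P: primeideal P R by fact
    have sub: "P \<subseteq> \<mm>" "P \<subseteq> Q"
      using S_mem P(2) P.Icarr by blast+
    obtain M where M: "maximalideal M R" "Q \<subseteq> M"
      using assms(1) Q(1) unfolding gelfand_ring_def by blast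
    have "M = \<mm>"
      using assms(1) P(1) M sub assms(2) unfolding gelfand_ring_def by blast
    then show False
      using J(3) Q(2) M(2) u(3) by blast
  qed
  then obtain b r where br: "b \<in> K" "r \<in> carrier R" "\<one> = b \<oplus> r \<otimes> u"
    using J(4) by blast
  have "a = (b \<oplus> r \<otimes> u) \<otimes> a"
    using u(1) by (simp add: br(3)[symmetric])
  also have "\<dots> = b \<otimes> a \<oplus> r \<otimes> (u \<otimes> a)"
    using br(2) K.Icarr[OF br(1)] u(1,2) by algebra
  also have "\<dots> = b \<otimes> a"
    using br(2) K.Icarr[OF br(1)] u(1,2,4) by simp
  finally show ?thesis
    using br(1) unfolding K_def[symmetric] by (intro bexI[of _ b]) simp_all
qed


section \<open>Calculating in a tensor product\<close>

lemma subgroup_tensor_subgroup: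
  assumes "module R M" "module R N"
  shows "subgroup (tensor_subgroup R M N) (free_Abelian_group (carrier M \<times> carrier N))"
  unfolding tensor_subgroup_def
proof (rule group.generate_is_subgroup[OF group_free_Abelian_group])
  interpret M: module R M by fact
  interpret N: module R N by fact
  let ?G = "carrier (free_Abelian_group (carrier M \<times> carrier N))"
  have diff: "c - d \<in> ?G" if "c \<in> ?G" "d \<in> ?G" for c d
    using that keys_diff[of c d] by auto
  show "tensor_rels R M N \<subseteq> ?G"
    unfolding tensor_rels_def by (auto simp del: carrier_free_Abelian_group_iff intro!: diff)
qed

lemma tensor_subgroup_diff:
  assumes "module R M" "module R N"
    and "c \<in> tensor_subgroup R M N" "d \<in> tensor_subgroup R M N"
  shows "c - d \<in> tensor_subgroup R M N"
proof -
  let ?G = "free_Abelian_group (carrier M \<times> carrier N)"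
  interpret subgroup "tensor_subgroup R M N" ?G
    using assms by (intro subgroup_tensor_subgroup)
  have "c \<otimes>\<^bsub>?G\<^esub> inv\<^bsub>?G\<^esub> d \<in> tensor_subgroup R M N"
    by (rule m_closed[OF assms(3) m_inv_closed[OF assms(4)]])
  moreover have "Poly_Mapping.keys d \<subseteq> carrier M \<times> carrier N"
    using mem_carrier[OF assms(4)] by simp
  ultimately show ?thesis
    by simp
qed

lemma tensor_subgroup_zero: "0 \<in> tensor_subgroup R M N"
  unfolding tensor_subgroup_def
  using generate.one[of "free_Abelian_group (carrier M \<times> carrier N)" "tensor_rels R M N"] by simp

lemma tensor_subgroup_add:
  assumes "module R M" "module R N"
    and "c \<in> tensor_subgroup R M N" "d \<in> tensor_subgroup R M N"
  shows "c + d \<in> tensor_subgroup R M N"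
  using tensor_subgroup_diff[OF assms(1,2,3) tensor_subgroup_diff[OF assms(1,2) tensor_subgroup_zero assms(4)]]
  by simp

lemma tensor_subgroup_additive_left:
  assumes "x \<in> carrier M" "x' \<in> carrier M" "y \<in> carrier N"
  shows "frag_of (x \<oplus>\<^bsub>M\<^esub> x', y) - frag_of (x, y) - frag_of (x', y) \<in> tensor_subgroup R M N"
  unfolding tensor_subgroup_def
  by (rule generate.incl) (use assms in \<open>auto simp: tensor_rels_def\<close>)

lemma tensor_subgroup_additive_right:
  assumes "x \<in> carrier M" "y \<in> carrier N" "y' \<in> carrier N"
  shows "frag_of (x, y \<oplus>\<^bsub>N\<^esub> y') - frag_of (x, y) - frag_of (x, y') \<in> tensor_subgroup R M N"
  unfolding tensor_subgroup_def
  by (rule generate.incl) (use assms in \<open>auto simp: tensor_rels_def\<close>)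

lemma tensor_subgroup_balanced:
  assumes "r \<in> carrier R" "x \<in> carrier M" "y \<in> carrier N"
  shows "frag_of (r \<odot>\<^bsub>M\<^esub> x, y) - frag_of (x, r \<odot>\<^bsub>N\<^esub> y) \<in> tensor_subgroup R M N"
  unfolding tensor_subgroup_def
  by (rule generate.incl) (use assms in \<open>auto simp: tensor_rels_def\<close>)

lemma tensor_subgroup_zero_right:
  assumes "module R M" "module R N" "x \<in> carrier M"
  shows "frag_of (x, \<zero>\<^bsub>N\<^esub>) \<in> tensor_subgroup R M N"
proof -
  interpret N: module R N by fact
  have "0 - (frag_of (x, \<zero>\<^bsub>N\<^esub> \<oplus>\<^bsub>N\<^esub> \<zero>\<^bsub>N\<^esub>) - frag_of (x, \<zero>\<^bsub>N\<^esub>) - frag_of (x, \<zero>\<^bsub>N\<^esub>))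
      \<in> tensor_subgroup R M N"
    using assms(3)
    by (intro tensor_subgroup_diff[OF assms(1,2) tensor_subgroup_zero]
        tensor_subgroup_additive_right) auto
  then show ?thesis
    by simp
qed

lemma tensor_subgroup_diff_left:
  assumes "module R M" "module R N" "x \<in> carrier M" "x' \<in> carrier M" "y \<in> carrier N"
  shows "frag_of (x \<ominus>\<^bsub>M\<^esub> x', y) - (frag_of (x, y) - frag_of (x', y)) \<in> tensor_subgroup R M N"
proof -
  interpret M: module R M by fact
  have eq: "(x \<ominus>\<^bsub>M\<^esub> x') \<oplus>\<^bsub>M\<^esub> x' = x"
    using assms by (simp add: M.M.minus_eq M.M.a_assoc M.M.l_neg)
  have "0 - (frag_of ((x \<ominus>\<^bsub>M\<^esub> x') \<oplus>\<^bsub>M\<^esub> x', y) - frag_of (x \<ominus>\<^bsub>M\<^esub> x', y) - frag_of (x', y))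
      \<in> tensor_subgroup R M N"
    using assms(3-5)
    by (intro tensor_subgroup_diff[OF assms(1,2) tensor_subgroup_zero]
        tensor_subgroup_additive_left) auto
  then show ?thesis
    unfolding eq by (simp add: algebra_simps)
qed

text \<open>The induced map is described on cosets, as a union over representatives. A trivial kernel
  suffices for injectivity without first showing that this union is a single coset: equality of two
  values puts the image of one representative of the first coset into the coset of the image of some
  representative of the second.\<close>

lemma inj_on_tensor_map_leftI:
  assumes "module R L" "module R N" "module R M"
    and kernel: "\<And>d. Poly_Mapping.keys d \<subseteq> carrier L \<times> carrier M \<Longrightarrow>
      frag_extend (\<lambda>(x, y). frag_of (f x, y)) d \<in> tensor_subgroup R N M \<Longrightarrow>
      d \<in> tensor_subgroup R L M"
  shows "inj_on (tensor_map_left R N M f) (carrier (tensor_product R L M))"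
proof (rule inj_onI)
  let ?GL = "free_Abelian_group (carrier L \<times> carrier M)"
  let ?GN = "free_Abelian_group (carrier N \<times> carrier M)"
  let ?TL = "tensor_subgroup R L M"
  let ?TN = "tensor_subgroup R N M"
  let ?F = "frag_extend (\<lambda>(x, y). frag_of (f x, y))"
  have TL: "subgroup ?TL ?GL"
    using assms by (intro subgroup_tensor_subgroup)
  fix C1 C2
  assume "C1 \<in> carrier (tensor_product R L M)" "C2 \<in> carrier (tensor_product R L M)"
    and eq: "tensor_map_left R N M f C1 = tensor_map_left R N M f C2"
  then obtain c1 c2 where c1: "c1 \<in> carrier ?GL" "C1 = ?TL #>\<^bsub>?GL\<^esub> c1"
    and c2: "c2 \<in> carrier ?GL" "C2 = ?TL #>\<^bsub>?GL\<^esub> c2"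
    by (auto simp: tensor_product_def FactGroup_def RCOSETS_def)
  have "c1 \<in> C1"
    unfolding c1 using TL c1(1) by (intro group.rcos_self) auto
  moreover have "?F c1 \<in> ?TN #>\<^bsub>?GN\<^esub> ?F c1"
    using tensor_subgroup_zero[of R N M] by (force simp: r_coset_def)
  ultimately have "?F c1 \<in> tensor_map_left R N M f C2"
    unfolding eq[symmetric] by (auto simp: tensor_map_left_def)
  then obtain c where c: "c \<in> C2" "?F c1 \<in> ?TN #>\<^bsub>?GN\<^esub> ?F c"
    by (auto simp: tensor_map_left_def)
  then obtain t where t: "t \<in> ?TN" "?F c1 = t + ?F c"
    by (auto simp: r_coset_def)
  have c_carr: "c \<in> carrier ?GL"
    using c(1) unfolding c2(2)
    by (rule subgroup.elemrcos_carrier[OF TL group_free_Abelian_group c2(1)])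
  have "?F (c1 - c) \<in> ?TN"
    using t by (simp add: frag_extend_diff)
  moreover have "Poly_Mapping.keys (c1 - c) \<subseteq> carrier L \<times> carrier M"
    using c1(1) c_carr keys_diff[of c1 c] by auto
  ultimately have "c1 - c \<in> ?TL"
    by (rule kernel[rotated])
  then have "c1 \<in> ?TL #>\<^bsub>?GL\<^esub> c"
    by (force simp: r_coset_def)
  then have "?TL #>\<^bsub>?GL\<^esub> c = C1"
    unfolding c1(2) using c_carr TL by (intro group.repr_independence) auto
  moreover have "C2 = ?TL #>\<^bsub>?GL\<^esub> c"
    using c(1) c2 TL unfolding c2(2) by (intro group.repr_independence) auto
  ultimately show "C1 = C2"
    by simp
qed

lemma hom_free_Abelian_group_diff:
  assumes "abelian_group M" "h \<in> hom (free_Abelian_group S) (add_monoid M)"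
    and "Poly_Mapping.keys c \<subseteq> S" "Poly_Mapping.keys d \<subseteq> S"
  shows "h (c - d) = h c \<ominus>\<^bsub>M\<^esub> h d"
proof -
  interpret M: abelian_group M by fact
  interpret group_hom "free_Abelian_group S" "add_monoid M" h
    using assms(2) M.add.is_group by (intro group_hom.intro group_hom_axioms.intro) auto
  have "h (c \<otimes>\<^bsub>free_Abelian_group S\<^esub> inv\<^bsub>free_Abelian_group S\<^esub> d) = h c \<otimes>\<^bsub>add_monoid M\<^esub> inv\<^bsub>add_monoid M\<^esub> h d"
    using assms(3,4)[folded carrier_free_Abelian_group_iff]
    by (simp only: hom_mult hom_inv G.inv_closed)
  then show ?thesis
    using assms(3,4) by (simp add: a_minus_def a_inv_def)
qed

lemma hom_free_Abelian_group_zero: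
  assumes "abelian_group M" "h \<in> hom (free_Abelian_group S) (add_monoid M)"
  shows "h 0 = \<zero>\<^bsub>M\<^esub>"
  using hom_one[OF assms(2) group_free_Abelian_group abelian_group.a_group[OF assms(1)]] by simp


section \<open>Quotients by pure ideals are flat\<close>

lemma module_restrict_scalars:
  assumes "cring R" "cring S" "h \<in> ring_hom R S"
  shows "module R (restrict_scalars R S h)"
proof -
  interpret R: cring R by fact
  interpret S: cring S by fact
  interpret ring_hom_cring R S h
    using assms R.ring_axioms S.ring_axioms by (intro ring_hom_cringI ring_hom_ringI2)
  have "abelian_group (restrict_scalars R S h)"
    using S.a_comm_group
    by (intro abelian_groupI) (auto simp: restrict_scalars_def S.a_ac intro: S.l_neg)
  then show ?thesis
    by (intro moduleI)
       (auto simp: restrict_scalars_def assms(1) S.l_distr S.r_distr S.m_assoc)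
qed

text \<open>Two elements fixed by \<open>b\<close> and \<open>c\<close> are both fixed by \<open>b + c - b c\<close>, since
  \<open>1 - (b + c - b c) = (1 - b) (1 - c)\<close>. This is what lets one element of the ideal serve for a
  whole finite sum.\<close>

lemma (in module) submodule_fixed_by_ideal:
  assumes "ideal I R"
  shows "submodule {x \<in> carrier M. \<exists>b\<in>I. b \<odot>\<^bsub>M\<^esub> x = x} R M" (is "submodule ?H R M")
proof (rule submoduleI)
  interpret I: ideal I R by fact
  show "\<zero>\<^bsub>M\<^esub> \<in> ?H"
  proof -
    have "\<exists>b\<in>I. b \<odot>\<^bsub>M\<^esub> \<zero>\<^bsub>M\<^esub> = \<zero>\<^bsub>M\<^esub>"
      by (rule bexI[OF _ I.zero_closed]) simp
    then show ?thesis
      by blast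
  qed
  show "\<ominus>\<^bsub>M\<^esub> x \<in> ?H" if "x \<in> ?H" for x
    using that I.Icarr by (auto simp: smult_r_minus intro!: bexI)
  show "x \<oplus>\<^bsub>M\<^esub> y \<in> ?H" if xy: "x \<in> ?H" "y \<in> ?H" for x y
  proof -
    obtain b c where bc: "b \<in> I" "b \<odot>\<^bsub>M\<^esub> x = x" "c \<in> I" "c \<odot>\<^bsub>M\<^esub> y = y"
      using xy by blast
    note carr = xy[THEN CollectD, THEN conjunct1] I.Icarr[OF bc(1)] I.Icarr[OF bc(3)]
    let ?d = "(b \<oplus> c) \<oplus> (\<ominus> (b \<otimes> c))"
    have dx: "?d \<odot>\<^bsub>M\<^esub> x = x"
    proof -
      have "(b \<otimes> c) \<odot>\<^bsub>M\<^esub> x = c \<odot>\<^bsub>M\<^esub> x"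
        using carr bc(2) smult_assoc1[of c b x] by (simp add: R.m_comm)
      then show ?thesis
        using carr bc(2) by (simp add: smult_l_distr smult_l_minus M.a_assoc M.r_neg)
    qed
    have dy: "?d \<odot>\<^bsub>M\<^esub> y = y"
    proof -
      have "(b \<otimes> c) \<odot>\<^bsub>M\<^esub> y = b \<odot>\<^bsub>M\<^esub> y"
        using carr bc(4) smult_assoc1[of b c y] by simp
      moreover have "b \<odot>\<^bsub>M\<^esub> y \<oplus>\<^bsub>M\<^esub> y \<oplus>\<^bsub>M\<^esub> \<ominus>\<^bsub>M\<^esub> (b \<odot>\<^bsub>M\<^esub> y) = y"
        using carr by (simp add: M.a_ac M.r_neg)
      ultimately show ?thesis
        using carr bc(4) by (simp add: smult_l_distr smult_l_minus)
    qed
    have "?d \<in> I"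
      using bc carr by (intro I.a_closed I.a_inv_closed I.I_r_closed) auto
    moreover have "?d \<odot>\<^bsub>M\<^esub> (x \<oplus>\<^bsub>M\<^esub> y) = x \<oplus>\<^bsub>M\<^esub> y"
      using carr dx dy by (simp add: smult_r_distr)
    ultimately show ?thesis
      using carr by blast
  qed
  show "a \<odot>\<^bsub>M\<^esub> x \<in> ?H" if a: "a \<in> carrier R" and x: "x \<in> ?H" for a x
  proof -
    obtain b where b: "b \<in> I" "b \<odot>\<^bsub>M\<^esub> x = x"
      using x by blast
    have "b \<odot>\<^bsub>M\<^esub> (a \<odot>\<^bsub>M\<^esub> x) = a \<odot>\<^bsub>M\<^esub> (b \<odot>\<^bsub>M\<^esub> x)"
      using a x I.Icarr[OF b(1)] by (metis (no_types, lifting) CollectD R.m_comm smult_assoc1)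
    then show ?thesis
      using a x b by auto
  qed
qed auto

text \<open>Choosing a representative of every coset makes \<open>(x, c) \<mapsto> coset_rep c \<odot> x\<close> a map into \<open>M\<close> itself,
  in place of the canonical map into \<open>M/IM\<close>. It is additive in \<open>c\<close> and balanced only up to elements
  \<open>a \<odot> x\<close> with \<open>a \<in> I\<close>, which is enough below and avoids quotient modules.\<close>

definition coset_rep :: "'a set \<Rightarrow> 'a" where
  "coset_rep c = (SOME r. r \<in> c)"

abbreviation quotient_module :: "('a, 'b) ring_scheme \<Rightarrow> 'a set \<Rightarrow> ('a, 'a set) module" where
  "quotient_module R I \<equiv> restrict_scalars R (R Quot I) (\<lambda>a. I +>\<^bsub>R\<^esub> a)"

lemma (in ideal) coset_rep:
  assumes "c \<in> carrier (quotient_module R I)"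
  shows "coset_rep c \<in> carrier R" "I +> coset_rep c = c"
proof -
  obtain r where r: "r \<in> carrier R" "c = I +> r"
    using assms by (auto simp: restrict_scalars_def FactRing_simps)
  then have "r \<in> c"
    using a_rcos_self by blast
  then have rep: "coset_rep c \<in> c"
    unfolding coset_rep_def by (rule someI)
  then show carr: "coset_rep c \<in> carrier R"
    using r a_r_coset_subset_G a_subset by blast
  show "I +> coset_rep c = c"
    using rep unfolding r(2) by (rule a_repr_independence[OF _ r(1) a_subgroup, symmetric])
qed

lemma (in module) contraction_tensor_quotient:
  assumes "ideal I R"
  obtains h where
    "h \<in> hom (free_Abelian_group (carrier M \<times> carrier (quotient_module R I))) (add_monoid M)"
    "\<And>x c. x \<in> carrier M \<Longrightarrow> c \<in> carrier (quotient_module R I) \<Longrightarrow>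
       h (frag_of (x, c)) = coset_rep c \<odot>\<^bsub>M\<^esub> x"
proof -
  interpret I: ideal I R by fact
  have "(\<lambda>(x, c). coset_rep c \<odot>\<^bsub>M\<^esub> x) ` (carrier M \<times> carrier (quotient_module R I))
      \<subseteq> carrier (add_monoid M)"
    using I.coset_rep(1) by auto
  from comm_group.free_Abelian_group_universal[OF M.a_comm_group this] that show ?thesis
    by (metis (no_types, lifting) SigmaI case_prod_conv)
qed

text \<open>The submodule of elements fixed by some member of \<open>I\<close> absorbs the failure of the contraction to
  respect the tensor relations: each relation goes to \<open>0\<close> or to some \<open>a \<odot> x\<close> with \<open>a \<in> I\<close>, and
  \<open>b a = a\<close> shows that \<open>b\<close> fixes \<open>a \<odot> x\<close>.\<close>

lemma (in module) contraction_of_tensor_subgroup: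
  assumes "ideal I R"
    and pure: "\<And>a. a \<in> I \<Longrightarrow> \<exists>b\<in>I. b \<otimes> a = a"
    and h: "h \<in> hom (free_Abelian_group (carrier M \<times> carrier (quotient_module R I))) (add_monoid M)"
    and h_of: "\<And>x c. x \<in> carrier M \<Longrightarrow> c \<in> carrier (quotient_module R I) \<Longrightarrow>
       h (frag_of (x, c)) = coset_rep c \<odot>\<^bsub>M\<^esub> x"
    and "d \<in> tensor_subgroup R M (quotient_module R I)"
  shows "\<exists>b\<in>I. b \<odot>\<^bsub>M\<^esub> h d = h d"
proof -
  let ?Q = "quotient_module R I"
  let ?G = "free_Abelian_group (carrier M \<times> carrier ?Q)"
  let ?H = "{x \<in> carrier M. \<exists>b\<in>I. b \<odot>\<^bsub>M\<^esub> x = x}"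
  interpret I: ideal I R by fact
  interpret Q: module R ?Q
    using R.is_cring I.quotient_is_cring I.rcos_ring_hom by (intro module_restrict_scalars)
  interpret H: submodule ?H R M
    using \<open>ideal I R\<close> by (rule submodule_fixed_by_ideal)
  interpret h: group_hom ?G "add_monoid M" h
    using h M.add.is_group by (intro group_hom.intro group_hom_axioms.intro) auto
  have QM: "module R ?Q" "module R M" by unfold_locales
  note h_diff = hom_free_Abelian_group_diff[OF M.abelian_group_axioms h]
  have mult_H: "a \<odot>\<^bsub>M\<^esub> x \<in> ?H" if a: "a \<in> I" and x: "x \<in> carrier M" for a x
  proof -
    obtain b where b: "b \<in> I" "b \<otimes> a = a"
      using pure a by blast
    then have "b \<odot>\<^bsub>M\<^esub> (a \<odot>\<^bsub>M\<^esub> x) = a \<odot>\<^bsub>M\<^esub> x"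
      using x I.Icarr[OF a] I.Icarr[OF b(1)] smult_assoc1[of b a x] by simp
    then show ?thesis
      using x I.Icarr[OF a] b(1) by blast
  qed
  have smult_diff: "(r \<ominus> s) \<odot>\<^bsub>M\<^esub> x = r \<odot>\<^bsub>M\<^esub> x \<ominus>\<^bsub>M\<^esub> s \<odot>\<^bsub>M\<^esub> x"
    if "r \<in> carrier R" "s \<in> carrier R" "x \<in> carrier M" for r s x
    using that by (simp add: R.minus_eq M.minus_eq smult_l_distr smult_l_minus)
  have rel_H: "h k \<in> ?H" if k: "k \<in> tensor_rels R M ?Q" for k
    using k unfolding tensor_rels_def
  proof (elim UnE CollectE exE conjE)
    fix x x' y
    assume k: "k = frag_of (x \<oplus>\<^bsub>M\<^esub> x', y) - frag_of (x, y) - frag_of (x', y)"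
      and xy: "x \<in> carrier M" "x' \<in> carrier M" "y \<in> carrier ?Q"
    note r = I.coset_rep(1)[OF xy(3)]
    have "h k = coset_rep y \<odot>\<^bsub>M\<^esub> (x \<oplus>\<^bsub>M\<^esub> x') \<ominus>\<^bsub>M\<^esub> coset_rep y \<odot>\<^bsub>M\<^esub> x \<ominus>\<^bsub>M\<^esub> coset_rep y \<odot>\<^bsub>M\<^esub> x'"
      using xy keys_diff[of "frag_of (x \<oplus>\<^bsub>M\<^esub> x', y)" "frag_of (x, y)"]
      unfolding k by (subst h_diff; (subst h_diff)?) (auto simp: h_of)
    also have "\<dots> = \<zero>\<^bsub>M\<^esub>"
      using xy r by (simp add: smult_r_distr M.minus_eq M.a_ac M.r_neg M.r_neg1 M.r_neg2)
    finally show "h k \<in> ?H"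
      using H.one_closed by simp
  next
    fix x y y'
    assume k: "k = frag_of (x, y \<oplus>\<^bsub>?Q\<^esub> y') - frag_of (x, y) - frag_of (x, y')"
      and xy: "x \<in> carrier M" "y \<in> carrier ?Q" "y' \<in> carrier ?Q"
    have yy: "y \<oplus>\<^bsub>?Q\<^esub> y' \<in> carrier ?Q"
      using xy by simp
    note r = I.coset_rep[OF xy(2)] I.coset_rep[OF xy(3)] I.coset_rep[OF yy]
    have "h k = coset_rep (y \<oplus>\<^bsub>?Q\<^esub> y') \<odot>\<^bsub>M\<^esub> x \<ominus>\<^bsub>M\<^esub> coset_rep y \<odot>\<^bsub>M\<^esub> x \<ominus>\<^bsub>M\<^esub> coset_rep y' \<odot>\<^bsub>M\<^esub> x"
      using xy yy keys_diff[of "frag_of (x, y \<oplus>\<^bsub>?Q\<^esub> y')" "frag_of (x, y)"]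
      unfolding k by (subst h_diff; (subst h_diff)?) (auto simp: h_of)
    also have "\<dots> = (coset_rep (y \<oplus>\<^bsub>?Q\<^esub> y') \<ominus> (coset_rep y \<oplus> coset_rep y')) \<odot>\<^bsub>M\<^esub> x"
      using xy r by (simp add: smult_diff smult_l_distr M.minus_eq M.minus_add M.a_assoc)
    finally have hk: "h k = \<dots>" .
    have "I +> coset_rep (y \<oplus>\<^bsub>?Q\<^esub> y') = I +> (coset_rep y \<oplus> coset_rep y')"
      using r I.a_rcos_sum[of "coset_rep y" "coset_rep y'"]
      by (simp add: restrict_scalars_def FactRing_def)
    then have "coset_rep (y \<oplus>\<^bsub>?Q\<^esub> y') \<ominus> (coset_rep y \<oplus> coset_rep y') \<in> I"
      using r by (simp add: R.quotient_eq_iff_same_a_r_cos[OF \<open>ideal I R\<close>])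
    then show "h k \<in> ?H"
      unfolding hk using xy(1) by (rule mult_H)
  next
    fix r x y
    assume k: "k = frag_of (r \<odot>\<^bsub>M\<^esub> x, y) - frag_of (x, r \<odot>\<^bsub>?Q\<^esub> y)"
      and xy: "r \<in> carrier R" "x \<in> carrier M" "y \<in> carrier ?Q"
    have ry: "r \<odot>\<^bsub>?Q\<^esub> y \<in> carrier ?Q"
      using xy by simp
    note rep = I.coset_rep[OF xy(3)] I.coset_rep[OF ry]
    have "h k = coset_rep y \<odot>\<^bsub>M\<^esub> (r \<odot>\<^bsub>M\<^esub> x) \<ominus>\<^bsub>M\<^esub> coset_rep (r \<odot>\<^bsub>?Q\<^esub> y) \<odot>\<^bsub>M\<^esub> x"
      using xy ry unfolding k by (subst h_diff) (auto simp: h_of)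
    also have "\<dots> = (r \<otimes> coset_rep y \<ominus> coset_rep (r \<odot>\<^bsub>?Q\<^esub> y)) \<odot>\<^bsub>M\<^esub> x"
      using xy rep by (simp add: smult_diff smult_assoc1[symmetric] R.m_comm)
    finally have hk: "h k = \<dots>" .
    have "I +> (r \<otimes> coset_rep y) = I +> coset_rep (r \<odot>\<^bsub>?Q\<^esub> y)"
      using rep xy(1) I.rcoset_mult_add[of r "coset_rep y"]
      by (simp add: restrict_scalars_def FactRing_def)
    then have "r \<otimes> coset_rep y \<ominus> coset_rep (r \<odot>\<^bsub>?Q\<^esub> y) \<in> I"
      using rep xy(1) by (simp add: R.quotient_eq_iff_same_a_r_cos[OF \<open>ideal I R\<close>])
    then show "h k \<in> ?H"
      unfolding hk using xy(2) by (rule mult_H)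
  qed
  have T_carr: "k \<in> carrier ?G" if "k \<in> tensor_subgroup R M ?Q" for k
    using subgroup.mem_carrier[OF subgroup_tensor_subgroup[OF QM(2,1)] that] .
  have "h d \<in> ?H"
    using assms(5) unfolding tensor_subgroup_def
  proof (induction rule: generate.induct)
    case one
    then show ?case
      using H.one_closed h.hom_one by simp
  next
    case (incl k)
    then show ?case by (rule rel_H)
  next
    case (inv k)
    then have "k \<in> carrier ?G"
      by (intro T_carr) (auto simp: tensor_subgroup_def intro: generate.incl)
    then show ?case
      using H.m_inv_closed[OF rel_H[OF inv]] by (simp only: h.hom_inv)
  next
    case (eng c d)
    then have "c \<in> carrier ?G" "d \<in> carrier ?G"
      by (auto simp only: T_carr tensor_subgroup_def)
    then show ?case
      using H.m_closed[OF eng.IH] by (simp only: h.hom_mult)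
  qed
  then show ?thesis
    by blast
qed

text \<open>On generators this is \<open>x \<otimes> c = x \<otimes> r 1 = r x \<otimes> 1\<close> for the chosen representative \<open>r\<close> of \<open>c\<close>;
  additivity of the contraction extends it to all sums.\<close>

lemma (in module) tensor_quotient_normal_form:
  assumes "ideal I R"
    and h: "h \<in> hom (free_Abelian_group (carrier M \<times> carrier (quotient_module R I))) (add_monoid M)"
    and h_of: "\<And>x c. x \<in> carrier M \<Longrightarrow> c \<in> carrier (quotient_module R I) \<Longrightarrow>
       h (frag_of (x, c)) = coset_rep c \<odot>\<^bsub>M\<^esub> x"
    and d: "Poly_Mapping.keys d \<subseteq> carrier M \<times> carrier (quotient_module R I)"
  shows "d - frag_of (h d, I +> \<one>) \<in> tensor_subgroup R M (quotient_module R I)"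
  using d
proof (induction d rule: free_Abelian_group_induct[consumes 1, case_names zero diff basis])
  let ?Q = "quotient_module R I"
  let ?T = "tensor_subgroup R M ?Q"
  interpret I: ideal I R by fact
  interpret Q: module R ?Q
    using R.is_cring I.quotient_is_cring I.rcos_ring_hom by (intro module_restrict_scalars)
  have MQ: "module R M" "module R ?Q" by unfold_locales
  have one: "I +> \<one> \<in> carrier ?Q"
    by (auto simp: restrict_scalars_def FactRing_simps)
  have h_carr: "h c \<in> carrier M" if "Poly_Mapping.keys c \<subseteq> carrier M \<times> carrier ?Q" for c
    using hom_in_carrier[OF h, of c] that by simp
  note T_diff = tensor_subgroup_diff[OF MQ]
  note diff_left = tensor_subgroup_diff_left[OF MQ _ _ one]
  {
    case zero
    have "frag_of (\<zero>\<^bsub>M\<^esub> \<oplus>\<^bsub>M\<^esub> \<zero>\<^bsub>M\<^esub>, I +> \<one>) - frag_of (\<zero>\<^bsub>M\<^esub>, I +> \<one>) - frag_of (\<zero>\<^bsub>M\<^esub>, I +> \<one>) \<in> ?T"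
      using one by (intro tensor_subgroup_additive_left) auto
    then show ?case
      by (simp add: hom_free_Abelian_group_zero[OF M.abelian_group_axioms h])
  next
    case (diff c d)
    have "(c - frag_of (h c, I +> \<one>)) - (d - frag_of (h d, I +> \<one>))
        - (frag_of (h c \<ominus>\<^bsub>M\<^esub> h d, I +> \<one>) - (frag_of (h c, I +> \<one>) - frag_of (h d, I +> \<one>))) \<in> ?T"
      using diff h_carr by (intro T_diff[OF T_diff diff_left]) auto
    then show ?case
      using hom_free_Abelian_group_diff[OF M.abelian_group_axioms h diff(1,2)]
      by (simp add: algebra_simps)
  next
    case (basis p)
    then obtain x c where p: "p = (x, c)" "x \<in> carrier M" "c \<in> carrier ?Q"
      by auto
    note rep = I.coset_rep[OF p(3)]
    have "coset_rep c \<odot>\<^bsub>?Q\<^esub> (I +> \<one>) = c"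
      using rep I.rcoset_mult_add[of "coset_rep c" \<one>]
      by (simp add: restrict_scalars_def FactRing_def)
    then have "0 - (frag_of (coset_rep c \<odot>\<^bsub>M\<^esub> x, I +> \<one>) - frag_of (x, c)) \<in> ?T"
      using tensor_subgroup_balanced[of "coset_rep c" R x M "I +> \<one>" ?Q] rep(1) p(2) one
      by (intro T_diff[OF tensor_subgroup_zero]) simp
    then show ?case
      using p h_of by simp
  }
qed

text \<open>The contractions \<open>hL\<close> and \<open>hN\<close> of \<open>L\<close> and \<open>N\<close> use the same coset representatives, so they commute
  with the linear map \<open>f\<close>. An element \<open>d\<close> whose image vanishes therefore has \<open>f (hL d)\<close>, and by
  injectivity \<open>hL d\<close> itself, fixed by some \<open>b \<in> I\<close>; this kills the normal form \<open>hL d \<otimes> 1\<close> of \<open>d\<close>.\<close>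

lemma flat_quotient_of_pure:
  fixes R (structure)
  assumes "cring R" "ideal I R"
    and pure: "\<And>a. a \<in> I \<Longrightarrow> \<exists>b\<in>I. b \<otimes> a = a"
  shows "flat_module TYPE('l) TYPE('n) R (quotient_module R I)"
  unfolding flat_module_def
proof (intro conjI allI impI)
  let ?Q = "quotient_module R I"
  interpret R: cring R by fact
  interpret I: ideal I R by fact
  show Q: "module R ?Q"
    using R.is_cring I.quotient_is_cring I.rcos_ring_hom by (intro module_restrict_scalars)
  then interpret Q: module R ?Q .
  fix L :: "('a, 'l) module" and N :: "('a, 'n) module" and f
  assume L: "module R L" and N: "module R N" and f: "f \<in> mod_hom R L N" "inj_on f (carrier L)"
  interpret L: module R L by fact
  interpret N: module R N by fact
  have f_carr: "f x \<in> carrier N" if "x \<in> carrier L" for x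
    using f(1) that by (auto simp: mod_hom_def)
  have f_smult: "f (r \<odot>\<^bsub>L\<^esub> x) = r \<odot>\<^bsub>N\<^esub> f x" if "r \<in> carrier R" "x \<in> carrier L" for r x
    using f(1) that by (auto simp: mod_hom_def)
  have "f \<in> hom (add_monoid L) (add_monoid N)"
    using f(1) by (auto simp: mod_hom_def hom_def)
  then interpret f: abelian_group_hom L N f
    using L.M.add.is_group N.M.add.is_group
    by (intro abelian_group_homI L.M.abelian_group_axioms N.M.abelian_group_axioms
        group_hom.intro group_hom_axioms.intro)
  obtain hL where hL: "hL \<in> hom (free_Abelian_group (carrier L \<times> carrier ?Q)) (add_monoid L)"
    and hL_of: "\<And>x c. x \<in> carrier L \<Longrightarrow> c \<in> carrier ?Q \<Longrightarrow> hL (frag_of (x, c)) = coset_rep c \<odot>\<^bsub>L\<^esub> x"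
    using L.contraction_tensor_quotient[OF \<open>ideal I R\<close>] by metis
  obtain hN where hN: "hN \<in> hom (free_Abelian_group (carrier N \<times> carrier ?Q)) (add_monoid N)"
    and hN_of: "\<And>x c. x \<in> carrier N \<Longrightarrow> c \<in> carrier ?Q \<Longrightarrow> hN (frag_of (x, c)) = coset_rep c \<odot>\<^bsub>N\<^esub> x"
    using N.contraction_tensor_quotient[OF \<open>ideal I R\<close>] by metis
  let ?F = "frag_extend (\<lambda>(x, y). frag_of (f x, y))"
  have F_keys: "Poly_Mapping.keys (?F d) \<subseteq> carrier N \<times> carrier ?Q"
    if "Poly_Mapping.keys d \<subseteq> carrier L \<times> carrier ?Q" for d
    using keys_frag_extend[of "\<lambda>(x, y). frag_of (f x, y)" d] that f_carr
    by (fastforce split: prod.splits)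
  have natural: "hN (?F d) = f (hL d)" if "Poly_Mapping.keys d \<subseteq> carrier L \<times> carrier ?Q" for d
    using that
  proof (induction d rule: free_Abelian_group_induct[consumes 1, case_names zero diff basis])
    case zero
    then show ?case
      using hom_free_Abelian_group_zero[OF N.M.abelian_group_axioms hN]
        hom_free_Abelian_group_zero[OF L.M.abelian_group_axioms hL]
      by simp
  next
    case (diff c d)
    have "hL c \<in> carrier L" "hL d \<in> carrier L"
      using hom_in_carrier[OF hL] diff(1,2) by auto
    then show ?case
      using diff F_keys hom_free_Abelian_group_diff[OF N.M.abelian_group_axioms hN F_keys[OF diff(1)] F_keys[OF diff(2)]]
        hom_free_Abelian_group_diff[OF L.M.abelian_group_axioms hL diff(1,2)]
      by (simp add: frag_extend_diff L.M.minus_eq N.M.minus_eq)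
  next
    case (basis p)
    then show ?case
      using I.coset_rep(1) by (auto simp: hL_of hN_of f_carr f_smult)
  qed
  show "inj_on (tensor_map_left R N ?Q f) (carrier (tensor_product R L ?Q))"
  proof (rule inj_on_tensor_map_leftI[OF L N Q])
    fix d
    assume d: "Poly_Mapping.keys d \<subseteq> carrier L \<times> carrier ?Q" and Fd: "?F d \<in> tensor_subgroup R N ?Q"
    let ?T = "tensor_subgroup R L ?Q"
    let ?x = "hL d"
    have x: "?x \<in> carrier L"
      using hom_in_carrier[OF hL] d by auto
    have one: "I +> \<one> \<in> carrier ?Q"
      by (auto simp: restrict_scalars_def FactRing_simps)
    obtain b where b: "b \<in> I" "b \<odot>\<^bsub>N\<^esub> f ?x = f ?x"
      using N.contraction_of_tensor_subgroup[OF \<open>ideal I R\<close> pure hN hN_of Fd] natural[OF d] by auto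
    have b_carr: "b \<in> carrier R"
      using b(1) by (rule I.Icarr)
    have "b \<odot>\<^bsub>L\<^esub> ?x = ?x"
      using b(2) x b_carr by (intro inj_onD[OF f(2)]) (simp_all add: f_smult)
    moreover have "b \<odot>\<^bsub>?Q\<^esub> (I +> \<one>) = \<zero>\<^bsub>?Q\<^esub>"
      using b b_carr I.rcoset_mult_add[of b \<one>] R.a_rcos_zero[OF \<open>ideal I R\<close>]
      by (simp add: restrict_scalars_def FactRing_def)
    ultimately have "frag_of (?x, I +> \<one>) - frag_of (?x, \<zero>\<^bsub>?Q\<^esub>) \<in> ?T"
      using tensor_subgroup_balanced[of b R ?x L "I +> \<one>" ?Q] b_carr x one by simp
    from tensor_subgroup_add[OF L Q this tensor_subgroup_zero_right[OF L Q x]]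
    have "frag_of (?x, I +> \<one>) \<in> ?T"
      by simp
    from tensor_subgroup_add[OF L Q L.tensor_quotient_normal_form[OF \<open>ideal I R\<close> hL hL_of d] this]
    show "d \<in> ?T"
      by simp
  qed
qed

lemma pure_idealI:
  fixes R (structure)
  assumes "cring R" "ideal I R" "\<And>a. a \<in> I \<Longrightarrow> \<exists>b\<in>I. b \<otimes> a = a"
  shows "pure_ideal TYPE('l) TYPE('n) I R"
  using assms flat_quotient_of_pure[OF assms] ideal.rcos_ring_hom[OF assms(2)]
  by (simp add: pure_ideal_def flat_ring_hom_def)

section \<open>Localization kernels of Gelfand rings\<close>

theorem lemma3p13:
  fixes R :: "('a, 'b) ring_scheme" and \<mm> :: "'a set"
  assumes "gelfand_ring R"
    and "maximalideal \<mm> R"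
  shows "pure_ideal TYPE('l) TYPE('n)
           (a_kernel R (localization_at R \<mm>) (localization_map R \<mm>)) R"
proof (rule pure_idealI)
  show "cring R"
    using assms(1) by (simp add: gelfand_ring_def)
  then interpret primeideal \<mm> R
    using assms(2) by (intro cring.maximalideal_prime)
  show "ideal (a_kernel R (localization_at R \<mm>) (localization_map R \<mm>)) R"
    by (rule ideal_kernel_localization_map)
qed (rule gelfand_localization_kernel_pure[OF assms])

end
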